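(* Let $P,Q\ge 1$ and let $j_1,\dots,j_P$, $k_1,\dots,k_Q$, $j\in\frac{1}{2}\mathbb{N}$ be fixed spins. Let $I_A\otimes I_B\in\mathcal{H}^0_{AB}=\mathcal{H}^0_A\otimes\mathcal{H}^0_B$ be a normalized tensor product of intertwiners. Let $\widetilde{E}(A|B)$ be the boundary spin state entanglement of the (normalized) boundary state obtained from $\mathcal{P}[I_A\otimes I_B]\in H^{\partial}_{AB}$ by gluing the two intertwiners along their common spin-$j$ edge with the singlet state. Then $$\widetilde{E}(A|B)=\ln(2j+1).$$
   Context: For a spin $j\in\frac12\mathbb{N}=\{0,\frac12,1,\dots\}$, $V^j$ is the irreducible unitary representation of $\mathrm{SU}(2)$ of dimension $2j+1$, with standard orthonormal basis $|j,m\rangle$, $m=-j,-j+1,\dots,j$, diagonalizing $J^z$ (standard phase convention: $J^{\pm}=J^x\pm iJ^y$ have non-negative matrix elements). Intertwiner spaces: $\mathcal{H}^0_A=\mathrm{Inv}_{\mathrm{SU}(2)}[V^{j_1}\otimes\cdots\otimes V^{j_P}\otimes V^j]$ and $\mathcal{H}^0_B=\mathrm{Inv}_{\mathrm{SU}(2)}[V^{k_1}\otimes\cdots\otimes V^{k_Q}\otimes V^j]$ are the subspaces of $\mathrm{SU}(2)$-invariant vectors under the diagonal action, with the induced inner products, and $\mathcal{H}^0_{AB}=\mathcal{H}^0_A\otimes\mathcal{H}^0_B$. Elements of $\mathcal{H}^0_A$, $\mathcal{H}^0_B$ are called intertwiners. Boundary spaces: $H_A=V^{j_1}\otimes\cdots\otimes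 V^{j_P}$, $H_B=V^{k_1}\otimes\cdots\otimes V^{k_Q}$, $H^{\partial}_{AB}=H_A\otimes H_B$. Gluing map: $\mathcal{P}:\mathcal{H}^0_{AB}\to H^{\partial}_{AB}$ is the linear map with $$\mathcal{P}[I_A\otimes I_B]=\frac{1}{\sqrt{2j+1}}\sum_{m=-j}^{j}(-1)^{j-m}\,\langle j,m|I_A\otimes\langle j,-m|I_B,$$ where $\langle j,m|I_A\in H_A$ denotes the partial contraction of $I_A\in H_A\otimes V^j$ with $\langle j,m|$ on the factor $V^j$, and similarly for $B$. Entanglement: for a unit vector $\phi$ in a tensor product $X\otimes Y$ of finite-dimensional Hilbert spaces, its entanglement (between $X$ and $Y$) is the von Neumann entropy $-\mathrm{Tr}\,\rho_X\ln\rho_X$ of $\rho_X=\mathrm{Tr}_Y|\phi\rangle\langle\phi|$ (with $0\ln 0=0$). The boundary spin state entanglement $\widetilde{E}(A|B)$ of a unit vector $\psi\in\mathcal{H}^0_{AB}$ is the entanglement with respect to $H_A\otimes H_B$ of the normalized vector $\mathcal{P}[\psi]/\|\mathcal{P}[\psi]\|$. *)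

theory Defs
  imports "HOL-Analysis.Analysis" "HOL-Computational_Algebra.Polynomial"
begin

text \<open>
  Spins are encoded by their doubles: the natural number \<open>n\<close> stands for the spin \<open>j = n / 2\<close>, and the
  magnetic number \<open>m \<in> {-j, -j+1, \<dots>, j}\<close> for the natural number \<open>j + m \<in> {0..n}\<close>.  Thus \<open>-m\<close>
  corresponds to \<open>n - (j + m)\<close>, and \<open>j - m\<close> also equals \<open>n - (j + m)\<close>.
\<close>

definition spin :: "nat \<Rightarrow> real" where
  "spin n = real n / 2"


section \<open>The group SU(2) and its representation of spin \<open>j\<close>\<close>

definition adjoint2 :: "complex^2^2 \<Rightarrow> complex^2^2" where
  "adjoint2 g = (\<chi> r s. cnj (g $ s $ r))"

definition SU2 :: "(complex^2^2) set" where
  "SU2 = {g. adjoint2 g ** g = mat 1 \<and> det g = 1}"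

text \<open>
  \<open>V\<^sup>j\<close> is realised on binary forms of degree \<open>n = 2j\<close>, with
  \<open>|j,m\<rangle> = x\<^bsup>j+m\<^esup> y\<^bsup>j-m\<^esup> / sqrt ((j+m)! (j-m)!)\<close> and \<open>g\<close> acting by the substitution
  \<open>x \<mapsto> g\<^sub>1\<^sub>1 x + g\<^sub>2\<^sub>1 y\<close>, \<open>y \<mapsto> g\<^sub>1\<^sub>2 x + g\<^sub>2\<^sub>2 y\<close>.  The number \<open>spin_rep n g a b\<close> is
  \<open>\<langle>j,m'| g |j,m\<rangle>\<close> with \<open>a = j + m'\<close> and \<open>b = j + m\<close>; the polynomial below is the image of
  \<open>x\<^bsup>b\<^esup> y\<^bsup>n-b\<^esup>\<close> evaluated at \<open>y = 1\<close>.  The formula makes sense for every complex 2 by 2 matrix, and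
  for \<open>n = 1\<close> it gives back the matrix itself.
\<close>

definition spin_rep :: "nat \<Rightarrow> complex^2^2 \<Rightarrow> nat \<Rightarrow> nat \<Rightarrow> complex" where
  "spin_rep n g a b =
     of_real (sqrt (fact a * fact (n - a) / (fact b * fact (n - b)))) *
     coeff ([:g $ 2 $ 1, g $ 1 $ 1:] ^ b * [:g $ 2 $ 2, g $ 1 $ 2:] ^ (n - b)) a"

definition spin_ket_form :: "nat \<Rightarrow> nat \<Rightarrow> complex \<Rightarrow> complex \<Rightarrow> complex" where
  "spin_ket_form n b x y = x ^ b * y ^ (n - b) / of_real (sqrt (fact b * fact (n - b)))"

lemma homogeneous_linear_mult:
  fixes p :: "complex poly"
  assumes "degree p \<le> n"
  shows "(\<Sum>a\<le>Suc n. coeff ([:c, d:] * p) a * x ^ a * y ^ (Suc n - a))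
       = (d * x + c * y) * (\<Sum>a\<le>n. coeff p a * x ^ a * y ^ (n - a))"
proof -
  have "(\<Sum>a\<le>Suc n. coeff ([:c, d:] * p) a * x ^ a * y ^ (Suc n - a))
      = (\<Sum>a\<le>Suc n. c * coeff p a * x ^ a * y ^ (Suc n - a))
      + (\<Sum>a\<le>Suc n. coeff (pCons 0 (smult d p)) a * x ^ a * y ^ (Suc n - a))"
    by (simp add: sum.distrib [symmetric] algebra_simps mult_pCons_left del: sum.atMost_Suc)
  also have "(\<Sum>a\<le>Suc n. c * coeff p a * x ^ a * y ^ (Suc n - a))
      = (\<Sum>a\<le>n. c * coeff p a * x ^ a * y ^ (Suc n - a))"
    using assms by (simp add: coeff_eq_0)
  also have "\<dots> = c * y * (\<Sum>a\<le>n. coeff p a * x ^ a * y ^ (n - a))"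
    by (simp add: sum_distrib_left Suc_diff_le algebra_simps)
  also have "(\<Sum>a\<le>Suc n. coeff (pCons 0 (smult d p)) a * x ^ a * y ^ (Suc n - a))
      = d * x * (\<Sum>a\<le>n. coeff p a * x ^ a * y ^ (n - a))"
    by (subst sum.atMost_Suc_shift) (simp add: sum_distrib_left algebra_simps)
  finally show ?thesis by (simp add: algebra_simps)
qed

lemma degree_linear_power_le: "degree ([:c, d:] ^ k :: complex poly) \<le> k"
  using degree_power_le [of "[:c, d:]" k] by (auto split: if_splits intro: order_trans)

lemma homogeneous_linear_powers:
  fixes c :: complex
  shows "(\<Sum>a\<le>p + q. coeff ([:c, d:] ^ p * [:c', d':] ^ q) a * x ^ a * y ^ (p + q - a))
       = (d * x + c * y) ^ p * (d' * x + c' * y) ^ q"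
proof (induction p)
  case 0
  have "(\<Sum>a\<le>q. coeff ([:c', d':] ^ q) a * x ^ a * y ^ (q - a)) = (d' * x + c' * y) ^ q"
  proof (induction q)
    case (Suc q)
    show ?case
      using homogeneous_linear_mult [OF degree_linear_power_le [of c' d' q], of c' d' x y] Suc
      by (simp del: sum.atMost_Suc mult_pCons_left)
  qed simp
  then show ?case by simp
next
  case (Suc p)
  have "degree ([:c, d:] ^ p * [:c', d':] ^ q) \<le> p + q"
    by (meson add_mono degree_linear_power_le degree_mult_le order_trans)
  from homogeneous_linear_mult [OF this, of c d x y] Suc
  show ?case
    by (simp add: mult.assoc del: sum.atMost_Suc mult_pCons_left)
qed

lemma spin_rep_ket_form:
  assumes "b \<le> n"
  shows "(\<Sum>a\<le>n. spin_rep n g a b * spin_ket_form n a x y)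
       = spin_ket_form n b (g $ 1 $ 1 * x + g $ 2 $ 1 * y) (g $ 1 $ 2 * x + g $ 2 $ 2 * y)"
proof -
  have "(\<Sum>a\<le>n. spin_rep n g a b * spin_ket_form n a x y) =
    (\<Sum>a\<le>n. coeff ([:g $ 2 $ 1, g $ 1 $ 1:] ^ b * [:g $ 2 $ 2, g $ 1 $ 2:] ^ (n - b)) a
             * x ^ a * y ^ (n - a)) / of_real (sqrt (fact b * fact (n - b)))"
    unfolding sum_divide_distrib
    by (rule sum.cong) (auto simp: spin_rep_def spin_ket_form_def real_sqrt_divide real_sqrt_mult)
  then show ?thesis
    using assms homogeneous_linear_powers [where p = b and q = "n - b"]
    by (simp add: spin_ket_form_def)
qed

lemma spin_ket_forms_independent:
  assumes "\<And>x y. (\<Sum>a\<le>n. f a * spin_ket_form n a x y) = (\<Sum>a\<le>n. h a * spin_ket_form n a x y)"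
    and "a \<le> n"
  shows "f a = h a"
proof -
  let ?s = "\<lambda>a. complex_of_real (sqrt (fact a * fact (n - a)))"
  have "\<forall>x. (\<Sum>a\<le>n. f a / ?s a * x ^ a) = (\<Sum>a\<le>n. h a / ?s a * x ^ a)"
    using assms(1) [of _ 1] by (simp add: spin_ket_form_def)
  then have "f a / ?s a = h a / ?s a"
    using assms(2) by (subst (asm) polyfun_eq_coeffs) auto
  then show ?thesis by auto
qed

lemma spin_rep_one:
  assumes "a \<le> n" "b \<le> n"
  shows "spin_rep n (mat 1) a b = (if a = b then 1 else 0)"
proof (rule spin_ket_forms_independent [OF _ assms(1)])
  fix x y
  show "(\<Sum>a\<le>n. spin_rep n (mat 1) a b * spin_ket_form n a x y)
      = (\<Sum>a\<le>n. (if a = b then 1 else 0) * spin_ket_form n a x y)"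
    using assms(2) by (simp add: spin_rep_ket_form mat_def if_distrib [of "\<lambda>t. t * _"] cong: if_cong)
qed

lemma spin_rep_mult:
  assumes "a \<le> n" "b \<le> n"
  shows "spin_rep n (g ** h) a b = (\<Sum>c\<le>n. spin_rep n g a c * spin_rep n h c b)"
proof (rule spin_ket_forms_independent [OF _ assms(1)])
  fix x y
  let ?u = "g $ 1 $ 1 * x + g $ 2 $ 1 * y" and ?v = "g $ 1 $ 2 * x + g $ 2 $ 2 * y"
  have "(\<Sum>a\<le>n. (\<Sum>c\<le>n. spin_rep n g a c * spin_rep n h c b) * spin_ket_form n a x y)
      = (\<Sum>c\<le>n. spin_rep n h c b * (\<Sum>a\<le>n. spin_rep n g a c * spin_ket_form n a x y))"
    unfolding sum_distrib_left sum_distrib_right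
    by (subst sum.swap) (simp add: mult_ac)
  also have "\<dots> = (\<Sum>c\<le>n. spin_rep n h c b * spin_ket_form n c ?u ?v)"
    by (simp add: spin_rep_ket_form)
  also have "\<dots> = (\<Sum>a\<le>n. spin_rep n (g ** h) a b * spin_ket_form n a x y)"
    unfolding spin_rep_ket_form [OF assms(2)]
    by (simp add: matrix_matrix_mult_def sum_2 algebra_simps)
  finally show "(\<Sum>a\<le>n. spin_rep n (g ** h) a b * spin_ket_form n a x y)
      = (\<Sum>a\<le>n. (\<Sum>c\<le>n. spin_rep n g a c * spin_rep n h c b) * spin_ket_form n a x y)" ..
qed

lemma spin_ket_form_reproducing:
  "(\<Sum>b\<le>n. spin_ket_form n b x y * spin_ket_form n b u v) = (x * u + y * v) ^ n / fact n"
proof -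
  have "spin_ket_form n b x y * spin_ket_form n b u v
      = of_nat (n choose b) * (x * u) ^ b * (y * v) ^ (n - b) / fact n" if "b \<le> n" for b
  proof -
    have *: "complex_of_real (sqrt (fact b * fact (n - b))) * of_real (sqrt (fact b * fact (n - b)))
        = fact b * fact (n - b)"
      unfolding of_real_mult [symmetric] real_sqrt_mult_self by simp
    have "spin_ket_form n b x y * spin_ket_form n b u v
        = (x * u) ^ b * (y * v) ^ (n - b) / (fact b * fact (n - b))"
      unfolding spin_ket_form_def times_divide_times_eq * by (simp add: power_mult_distrib)
    also have "\<dots> = of_nat (n choose b) * (x * u) ^ b * (y * v) ^ (n - b) / fact n"
      using that by (simp add: binomial_fact)
    finally show ?thesis .
  qed
  then show ?thesis
    by (simp add: binomial_ring sum_divide_distrib)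
qed

lemma spin_rep_transpose:
  assumes "a \<le> n" "b \<le> n"
  shows "spin_rep n (transpose g) a b = spin_rep n g b a"
proof (rule spin_ket_forms_independent [OF _ assms(1)])
  have gen: "(\<Sum>b\<le>n. (\<Sum>a\<le>n. spin_rep n g a b * spin_ket_form n a x y) * spin_ket_form n b u v)
      = ((g $ 1 $ 1 * x + g $ 2 $ 1 * y) * u + (g $ 1 $ 2 * x + g $ 2 $ 2 * y) * v) ^ n / fact n"
    for g x y u v
    by (simp add: spin_rep_ket_form spin_ket_form_reproducing)
  fix x y
  show "(\<Sum>a\<le>n. spin_rep n (transpose g) a b * spin_ket_form n a x y)
      = (\<Sum>a\<le>n. spin_rep n g b a * spin_ket_form n a x y)"
  proof (rule spin_ket_forms_independent [OF _ assms(2)])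
    fix u v
    have "(\<Sum>b\<le>n. (\<Sum>a\<le>n. spin_rep n g b a * spin_ket_form n a x y) * spin_ket_form n b u v)
        = (\<Sum>a\<le>n. (\<Sum>b\<le>n. spin_rep n g b a * spin_ket_form n b u v) * spin_ket_form n a x y)"
      unfolding sum_distrib_left sum_distrib_right
      by (subst sum.swap) (simp add: mult_ac)
    then show "(\<Sum>b\<le>n. (\<Sum>a\<le>n. spin_rep n (transpose g) a b * spin_ket_form n a x y) * spin_ket_form n b u v)
        = (\<Sum>b\<le>n. (\<Sum>a\<le>n. spin_rep n g b a * spin_ket_form n a x y) * spin_ket_form n b u v)"
      unfolding gen by (simp add: transpose_def algebra_simps)
  qed
qed

lemma cnj_coeff_linear_power:
  "cnj (coeff ([:c, d:] ^ p * [:c', d':] ^ q) a)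
     = coeff ([:cnj c, cnj d:] ^ p * [:cnj c', cnj d':] ^ q) a"
proof -
  have *: "map_poly cnj (p * q) = map_poly cnj p * map_poly cnj q" for p q
    by (rule poly_eqI) (simp add: coeff_map_poly coeff_mult)
  have **: "map_poly cnj (p ^ k) = map_poly cnj p ^ k" for p k
    by (induction k) (simp_all add: *)
  have "cnj (coeff ([:c, d:] ^ p * [:c', d':] ^ q) a)
      = coeff (map_poly cnj ([:c, d:] ^ p * [:c', d':] ^ q)) a"
    by (simp add: coeff_map_poly)
  then show ?thesis
    by (simp add: * ** map_poly_pCons)
qed

lemma spin_rep_adjoint:
  assumes "a \<le> n" "b \<le> n"
  shows "spin_rep n (adjoint2 g) a b = cnj (spin_rep n g b a)"
proof -
  have "adjoint2 g = transpose (\<chi> r s. cnj (g $ r $ s))"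
    by (simp add: adjoint2_def transpose_def)
  then have "spin_rep n (adjoint2 g) a b = spin_rep n (\<chi> r s. cnj (g $ r $ s)) b a"
    using assms by (simp add: spin_rep_transpose)
  also have "\<dots> = cnj (spin_rep n g b a)"
    by (simp add: spin_rep_def cnj_coeff_linear_power)
  finally show ?thesis .
qed

lemma spin_rep_unitary:
  assumes "g \<in> SU2" "a \<le> n" "b \<le> n"
  shows "(\<Sum>c\<le>n. cnj (spin_rep n g c a) * spin_rep n g c b) = (if a = b then 1 else 0)"
proof -
  have "(\<Sum>c\<le>n. cnj (spin_rep n g c a) * spin_rep n g c b) = spin_rep n (adjoint2 g ** g) a b"
    using assms by (simp add: spin_rep_mult spin_rep_adjoint)
  then show ?thesis
    using assms by (simp add: SU2_def spin_rep_one)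
qed

text \<open>
  \<open>exp (-i t J\<^sup>z)\<close> acts on \<open>|j,m\<rangle>\<close> by \<open>exp (-i t m)\<close>, and \<open>J\<^sup>+\<close> and \<open>J\<^sup>-\<close>, the derivatives at 0 of
  the images of the two unipotent one-parameter groups, have the non-negative matrix elements
  \<open>sqrt ((j - m) (j + m + 1))\<close> and \<open>sqrt ((j + m) (j - m + 1))\<close> of the standard phase convention.
\<close>

lemma spin_rep_torus:
  assumes "a \<le> n" "b \<le> n"
  shows "spin_rep n (vector [vector [exp (- \<i> * of_real t / 2), 0], vector [0, exp (\<i> * of_real t / 2)]]) a b
       = (if a = b then exp (- \<i> * of_real t * of_real (real b - spin n)) else 0)"
proof (rule spin_ket_forms_independent [OF _ assms(1)])
  fix x y
  let ?z = "exp (- \<i> * of_real t / 2)" and ?w = "exp (\<i> * of_real t / 2)"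
  have "?z ^ b * ?w ^ (n - b)
      = exp (of_nat b * (- \<i> * of_real t / 2) + of_nat (n - b) * (\<i> * of_real t / 2))"
    by (simp only: exp_of_nat_mult exp_add)
  also have "of_nat b * (- \<i> * of_real t / 2) + of_nat (n - b) * (\<i> * of_real t / 2)
      = - \<i> * of_real t * of_real (real b - spin n)"
    using assms(2) by (simp add: spin_def of_nat_diff field_simps)
  finally have "?z ^ b * ?w ^ (n - b) = exp (- \<i> * of_real t * of_real (real b - spin n))" .
  then have "spin_ket_form n b (?z * x) (?w * y)
      = exp (- \<i> * of_real t * of_real (real b - spin n)) * spin_ket_form n b x y"
    by (simp add: spin_ket_form_def power_mult_distrib mult_ac del: of_real_diff)
  then show "(\<Sum>a\<le>n. spin_rep n (vector [vector [?z, 0], vector [0, ?w]]) a b * spin_ket_form n a x y)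
      = (\<Sum>a\<le>n. (if a = b then exp (- \<i> * of_real t * of_real (real b - spin n)) else 0)
          * spin_ket_form n a x y)"
    using assms(2)
    by (simp add: spin_rep_ket_form if_distrib [of "\<lambda>t. t * _"] cong: if_cong)
qed

lemma coeff_linear_power_one: "coeff ([:1, t:] ^ m) k = of_nat (m choose k) * (t :: complex) ^ k"
proof (induction m arbitrary: k)
  case (Suc m)
  then show ?case
    by (cases k) (simp_all add: mult_pCons_left coeff_pCons algebra_simps)
qed (cases k; simp)

lemma spin_rep_raising:
  "((\<lambda>t. spin_rep n (vector [vector [1, t], vector [0, 1]]) a b) has_field_derivative
      (if a = Suc b then of_real (sqrt (real (n - b) * real (b + 1))) else 0)) (at 0)"
  if "a \<le> n" "b \<le> n"
proof -
  have p: "[:0, 1:] ^ b = (monom 1 b :: complex poly)"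
    by (simp add: monom_altdef)
  have D: "spin_rep n (vector [vector [1, t], vector [0, 1]]) a b
      = of_real (sqrt (fact a * fact (n - a) / (fact b * fact (n - b))))
        * (if b \<le> a then of_nat ((n - b) choose (a - b)) * t ^ (a - b) else 0)" for t
    by (simp add: spin_rep_def p coeff_monom_mult coeff_linear_power_one)
  have pw: "((\<lambda>t :: complex. t ^ k) has_field_derivative (if k = 1 then 1 else 0)) (at 0)" for k
    by (cases k) (auto intro!: derivative_eq_intros simp: power_0_left)
  show ?thesis
  proof (cases "a = Suc b")
    case True
    define k where "k = n - Suc b"
    have k: "n - b = Suc k" "n - Suc b = k"
      using that True by (auto simp: k_def)
    have "fact (Suc b) * fact k / (fact b * fact (Suc k)) = real (Suc b) / real (Suc k)"
      by (simp add: frac_eq_eq del: of_nat_Suc)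
    then have "sqrt (fact (Suc b) * fact k / (fact b * fact (Suc k))) * real (Suc k)
        = sqrt (real (Suc b) / real (Suc k)) * (sqrt (real (Suc k)) * sqrt (real (Suc k)))"
      by (simp only: real_sqrt_mult_self abs_of_nat)
    also have "\<dots> = sqrt (real (Suc k) * real (b + 1))"
      unfolding real_sqrt_divide real_sqrt_mult by (simp del: of_nat_Suc real_sqrt_mult_self)
    finally have sq: "of_real (sqrt (fact (Suc b) * fact k / (fact b * fact (Suc k)))) * of_nat (Suc k)
        = complex_of_real (sqrt (real (Suc k) * real (b + 1)))"
      by (metis of_real_mult of_real_of_nat_eq)
    have "spin_rep n (vector [vector [1, t], vector [0, 1]]) a b
        = complex_of_real (sqrt (real (Suc k) * real (b + 1))) * t" for t
      unfolding D sq [symmetric] by (simp add: True k)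
    then show ?thesis
      using True k by (auto intro!: derivative_eq_intros)
  next
    case False
    show ?thesis
    proof (cases "b \<le> a")
      case True
      then have "a - b \<noteq> 1" using False by simp
      then show ?thesis
        using DERIV_cmult [OF pw [of "a - b"]] True False by (simp add: D flip: mult.assoc)
    next
      case False
      then show ?thesis by (simp add: D)
    qed
  qed
qed

lemma spin_rep_lowering:
  "((\<lambda>t. spin_rep n (vector [vector [1, 0], vector [t, 1]]) a b) has_field_derivative
      (if Suc a = b then of_real (sqrt (real b * real (n - b + 1))) else 0)) (at 0)"
  if "a \<le> n" "b \<le> n"
proof -
  have "transpose (vector [vector [1, t], vector [0, 1]]) = (vector [vector [1, 0], vector [t, 1]] :: complex^2^2)"
    for t by (simp add: transpose_def vec_eq_iff forall_2)
  then have "spin_rep n (vector [vector [1, 0], vector [t, 1]]) a b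
      = spin_rep n (vector [vector [1, t], vector [0, 1]]) b a" for t
    using that by (metis spin_rep_transpose)
  then show ?thesis
    using spin_rep_raising [OF that(2,1)] that by (auto simp: mult.commute Suc_diff_le Suc_diff_Suc)
qed


section \<open>Tensor products of spins and intertwiners\<close>

text \<open>
  A vector of \<open>V\<^bsup>j\<^sub>1\<^esup> \<otimes> \<dots> \<otimes> V\<^bsup>j\<^sub>P\<^esup>\<close> is the function of its coefficients in the product basis, which is
  labelled by the lists of the \<open>j\<^sub>i + m\<^sub>i\<close>; it vanishes on all other lists.  A vector of a tensor
  product of two such spaces is a function of a pair of lists.
\<close>

definition spin_labels :: "nat list \<Rightarrow> nat list set" where
  "spin_labels ns = {as. list_all2 (\<le>) as ns}"

definition spin_tensor_space :: "nat list \<Rightarrow> (nat list \<Rightarrow> complex) set" where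
  "spin_tensor_space ns = {v. \<forall>as. as \<notin> spin_labels ns \<longrightarrow> v as = 0}"

definition diagonal_action ::
    "nat list \<Rightarrow> complex^2^2 \<Rightarrow> (nat list \<Rightarrow> complex) \<Rightarrow> nat list \<Rightarrow> complex" where
  "diagonal_action ns g v as =
     (if as \<in> spin_labels ns
      then \<Sum>bs\<in>spin_labels ns. (\<Prod>i<length ns. spin_rep (ns ! i) g (as ! i) (bs ! i)) * v bs
      else 0)"

definition intertwiners :: "nat list \<Rightarrow> (nat list \<Rightarrow> complex) set" where
  "intertwiners ns = {v \<in> spin_tensor_space ns. \<forall>g\<in>SU2. diagonal_action ns g v = v}"

definition tensor :: "('a \<Rightarrow> complex) \<Rightarrow> ('b \<Rightarrow> complex) \<Rightarrow> 'a \<times> 'b \<Rightarrow> complex" where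
  "tensor u v = (\<lambda>(a, b). u a * v b)"

definition ket_norm :: "'a set \<Rightarrow> ('a \<Rightarrow> complex) \<Rightarrow> real" where
  "ket_norm X v = sqrt (\<Sum>x\<in>X. (cmod (v x))\<^sup>2)"


section \<open>Gluing along the common edge\<close>

text \<open>
  In both intertwiner spaces the common spin comes last.  \<open>glue n\<close> is defined on all vectors of the
  tensor product; by \<open>glue_tensor\<close> it takes the prescribed values on product vectors.
\<close>

definition contract_last :: "nat \<Rightarrow> (nat list \<Rightarrow> complex) \<Rightarrow> nat list \<Rightarrow> complex" where
  "contract_last c v as = v (as @ [c])"

definition glue ::
    "nat \<Rightarrow> (nat list \<times> nat list \<Rightarrow> complex) \<Rightarrow> nat list \<times> nat list \<Rightarrow> complex" where
  "glue n \<psi> = (\<lambda>(as, bs).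
     1 / of_real (sqrt (2 * spin n + 1)) * (\<Sum>c\<le>n. (-1) ^ (n - c) * \<psi> (as @ [c], bs @ [n - c])))"

lemma glue_tensor:
  "glue n (tensor u v) x =
     1 / of_real (sqrt (2 * spin n + 1)) *
     (\<Sum>c\<le>n. (-1) ^ (n - c) * tensor (contract_last c u) (contract_last (n - c) v) x)"
  by (simp add: glue_def tensor_def contract_last_def split: prod.split)

lemma glue_linear:
  "glue n (\<lambda>x. \<alpha> * \<phi> x + \<beta> * \<psi> x) x = \<alpha> * glue n \<phi> x + \<beta> * glue n \<psi> x"
  by (simp add: glue_def sum.distrib sum_distrib_left algebra_simps split: prod.split)


section \<open>Entanglement\<close>

text \<open>
  Operators on the space with orthonormal basis \<open>X\<close> are given by their matrix elements.
  \<open>spectral_fun X f A\<close> is \<open>f(A)\<close> for Hermitian \<open>A\<close>: if \<open>A = U diag(d) U\<^sup>*\<close> with \<open>U\<close> unitary and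
  \<open>d\<close> real, then \<open>f(A) = U diag(f \<circ> d) U\<^sup>*\<close>, independently of the choice of \<open>U\<close> and \<open>d\<close>.
\<close>

definition unitary_on :: "'a set \<Rightarrow> ('a \<Rightarrow> 'a \<Rightarrow> complex) \<Rightarrow> bool" where
  "unitary_on X U \<longleftrightarrow>
     (\<forall>k\<in>X. \<forall>l\<in>X. (\<Sum>x\<in>X. cnj (U x k) * U x l) = (if k = l then 1 else 0)) \<and>
     (\<forall>x\<in>X. \<forall>y\<in>X. (\<Sum>k\<in>X. U x k * cnj (U y k)) = (if x = y then 1 else 0))"

definition diag_conj ::
    "'a set \<Rightarrow> ('a \<Rightarrow> 'a \<Rightarrow> complex) \<Rightarrow> ('a \<Rightarrow> real) \<Rightarrow> 'a \<Rightarrow> 'a \<Rightarrow> complex" where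
  "diag_conj X U d x y =
     (if x \<in> X \<and> y \<in> X then \<Sum>k\<in>X. U x k * of_real (d k) * cnj (U y k) else 0)"

definition spectral_fun ::
    "'a set \<Rightarrow> (real \<Rightarrow> real) \<Rightarrow> ('a \<Rightarrow> 'a \<Rightarrow> complex) \<Rightarrow> 'a \<Rightarrow> 'a \<Rightarrow> complex" where
  "spectral_fun X f A = (THE B. \<exists>U d. unitary_on X U \<and>
     (\<forall>x\<in>X. \<forall>y\<in>X. A x y = diag_conj X U d x y) \<and> B = diag_conj X U (f \<circ> d))"

lemma diag_conj_unique:
  assumes X: "finite X" and U: "unitary_on X U" and V: "unitary_on X V"
    and eq: "\<And>x y. x \<in> X \<Longrightarrow> y \<in> X \<Longrightarrow> diag_conj X U d x y = diag_conj X V e x y"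
  shows "diag_conj X U (f \<circ> d) = diag_conj X V (f \<circ> e)"
proof -
  define W where "W l k = (\<Sum>x\<in>X. cnj (V x l) * U x k)" for l k
  have right: "(\<Sum>y\<in>X. diag_conj X U d x y * U y k) = U x k * of_real (d k)"
    if "x \<in> X" "k \<in> X" "unitary_on X U" for x k U and d :: "'a \<Rightarrow> real"
  proof -
    have "(\<Sum>y\<in>X. diag_conj X U d x y * U y k)
        = (\<Sum>y\<in>X. \<Sum>l\<in>X. U x l * of_real (d l) * (cnj (U y l) * U y k))"
      using that by (simp add: diag_conj_def sum_distrib_right mult.assoc)
    also have "\<dots> = (\<Sum>l\<in>X. U x l * of_real (d l) * (\<Sum>y\<in>X. cnj (U y l) * U y k))"
      by (subst sum.swap) (simp add: sum_distrib_left)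
    also have "\<dots> = (\<Sum>l\<in>X. U x l * of_real (d l) * (if l = k then 1 else 0))"
      using that by (intro sum.cong) (auto simp: unitary_on_def)
    also have "\<dots> = U x k * of_real (d k)"
      using that X by (simp add: if_distrib cong: if_cong)
    finally show ?thesis .
  qed
  have left: "(\<Sum>x\<in>X. cnj (U x l) * diag_conj X U d x y) = of_real (d l) * cnj (U y l)"
    if "y \<in> X" "l \<in> X" "unitary_on X U" for y l U and d :: "'a \<Rightarrow> real"
  proof -
    have "diag_conj X U d x y = cnj (diag_conj X U d y x)" for x
      by (simp add: diag_conj_def mult_ac)
    then have "(\<Sum>x\<in>X. cnj (U x l) * diag_conj X U d x y)
        = cnj (\<Sum>x\<in>X. diag_conj X U d y x * U x l)"
      by (simp add: mult.commute)
    then show ?thesis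
      using right [OF that] by simp
  qed
  have W: "of_real (e l) * W l k = W l k * of_real (d k)" if "l \<in> X" "k \<in> X" for l k
  proof -
    have "of_real (e l) * W l k
        = (\<Sum>y\<in>X. (\<Sum>x\<in>X. cnj (V x l) * diag_conj X V e x y) * U y k)"
      using that V by (simp add: left W_def sum_distrib_left mult.assoc)
    also have "\<dots> = (\<Sum>x\<in>X. cnj (V x l) * (\<Sum>y\<in>X. diag_conj X V e x y * U y k))"
      unfolding sum_distrib_left sum_distrib_right by (subst sum.swap) (simp add: mult.assoc)
    also have "\<dots> = (\<Sum>x\<in>X. cnj (V x l) * (\<Sum>y\<in>X. diag_conj X U d x y * U y k))"
      by (simp add: eq)
    also have "\<dots> = W l k * of_real (d k)"
      using that U by (simp add: right W_def sum_distrib_right mult.assoc)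
    finally show ?thesis .
  qed
  have fW: "of_real (f (e l)) * W l k = W l k * of_real (f (d k))" if "l \<in> X" "k \<in> X" for l k
    using W [OF that] by (cases "W l k = 0") auto
  have VW: "(\<Sum>l\<in>X. V x l * W l k) = U x k" if "x \<in> X" "k \<in> X" for x k
  proof -
    have "(\<Sum>l\<in>X. V x l * W l k) = (\<Sum>y\<in>X. (\<Sum>l\<in>X. V x l * cnj (V y l)) * U y k)"
      unfolding W_def sum_distrib_left sum_distrib_right by (subst sum.swap) (simp add: mult.assoc)
    also have "\<dots> = (\<Sum>y\<in>X. (if x = y then 1 else 0) * U y k)"
      using that V by (intro sum.cong) (auto simp: unitary_on_def)
    also have "\<dots> = U x k"
      using that X by (simp add: if_distrib [of "\<lambda>t. t * _"] cong: if_cong)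
    finally show ?thesis .
  qed
  have WU: "(\<Sum>k\<in>X. W l k * cnj (U y k)) = cnj (V y l)" if "y \<in> X" "l \<in> X" for y l
  proof -
    have "(\<Sum>k\<in>X. W l k * cnj (U y k)) = (\<Sum>x\<in>X. cnj (V x l) * (\<Sum>k\<in>X. U x k * cnj (U y k)))"
      unfolding W_def sum_distrib_left sum_distrib_right by (subst sum.swap) (simp add: mult.assoc)
    also have "\<dots> = (\<Sum>x\<in>X. cnj (V x l) * (if x = y then 1 else 0))"
      using that U by (intro sum.cong) (auto simp: unitary_on_def)
    also have "\<dots> = cnj (V y l)"
      using that X by (simp add: if_distrib cong: if_cong)
    finally show ?thesis .
  qed
  have "diag_conj X U (f \<circ> d) x y = diag_conj X V (f \<circ> e) x y" if "x \<in> X" "y \<in> X" for x y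
  proof -
    have "diag_conj X U (f \<circ> d) x y = (\<Sum>k\<in>X. (\<Sum>l\<in>X. V x l * W l k) * of_real (f (d k)) * cnj (U y k))"
      using that by (simp add: diag_conj_def VW)
    also have "\<dots> = (\<Sum>k\<in>X. \<Sum>l\<in>X. V x l * (W l k * of_real (f (d k))) * cnj (U y k))"
      by (simp add: sum_distrib_right mult.assoc)
    also have "\<dots> = (\<Sum>k\<in>X. \<Sum>l\<in>X. V x l * (of_real (f (e l)) * W l k) * cnj (U y k))"
      by (simp add: fW)
    also have "\<dots> = (\<Sum>l\<in>X. V x l * of_real (f (e l)) * (\<Sum>k\<in>X. W l k * cnj (U y k)))"
      unfolding sum_distrib_left by (subst sum.swap) (simp add: mult.assoc)
    also have "\<dots> = diag_conj X V (f \<circ> e) x y"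
      using that by (simp add: diag_conj_def WU)
    finally show ?thesis .
  qed
  then show ?thesis
    by (intro ext) (auto simp: diag_conj_def)
qed

lemma spectral_fun_eq:
  assumes "finite X" "unitary_on X U" "\<And>x y. x \<in> X \<Longrightarrow> y \<in> X \<Longrightarrow> A x y = diag_conj X U d x y"
  shows "spectral_fun X f A = diag_conj X U (f \<circ> d)"
  unfolding spectral_fun_def
proof (rule the_equality)
  show "\<exists>U' d'. unitary_on X U' \<and> (\<forall>x\<in>X. \<forall>y\<in>X. A x y = diag_conj X U' d' x y)
      \<and> diag_conj X U (f \<circ> d) = diag_conj X U' (f \<circ> d')"
    using assms by blast
next
  fix B
  assume "\<exists>U' d'. unitary_on X U' \<and> (\<forall>x\<in>X. \<forall>y\<in>X. A x y = diag_conj X U' d' x y)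
      \<and> B = diag_conj X U' (f \<circ> d')"
  then obtain U' d' where "unitary_on X U'" "\<forall>x\<in>X. \<forall>y\<in>X. A x y = diag_conj X U' d' x y"
    "B = diag_conj X U' (f \<circ> d')" by blast
  then show "B = diag_conj X U (f \<circ> d)"
    using diag_conj_unique [OF assms(1), of U' U d' d f] assms by simp
qed

text \<open>
  Since \<open>ln 0 = 0\<close> in HOL, \<open>\<rho> ln \<rho>\<close> vanishes on the kernel of \<open>\<rho>\<close>, as the convention \<open>0 ln 0 = 0\<close>
  demands.
\<close>

definition von_neumann_entropy :: "'a set \<Rightarrow> ('a \<Rightarrow> 'a \<Rightarrow> complex) \<Rightarrow> real" where
  "von_neumann_entropy X \<rho> = - Re (\<Sum>x\<in>X. \<Sum>y\<in>X. \<rho> x y * spectral_fun X ln \<rho> y x)"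

definition reduced_density :: "'b set \<Rightarrow> ('a \<times> 'b \<Rightarrow> complex) \<Rightarrow> 'a \<Rightarrow> 'a \<Rightarrow> complex" where
  "reduced_density Y \<phi> x x' = (\<Sum>y\<in>Y. \<phi> (x, y) * cnj (\<phi> (x', y)))"

definition entanglement :: "'a set \<Rightarrow> 'b set \<Rightarrow> ('a \<times> 'b \<Rightarrow> complex) \<Rightarrow> real" where
  "entanglement X Y \<phi> = von_neumann_entropy X (reduced_density Y \<phi>)"

definition boundary_entanglement ::
    "nat list \<Rightarrow> nat list \<Rightarrow> nat \<Rightarrow> (nat list \<times> nat list \<Rightarrow> complex) \<Rightarrow> real" where
  "boundary_entanglement js ks n \<psi> =
     (let X = spin_labels js; Y = spin_labels ks
      in entanglement X Y (\<lambda>x. glue n \<psi> x / of_real (ket_norm (X \<times> Y) (glue n \<psi>))))"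

end

theory Submission
  imports Defs
begin

text \<open>
  Contracting an intertwiner with the basis of the common edge gives \<open>2j + 1\<close> vectors of the
  boundary space.  By invariance their Gram matrix commutes with the irreducible representation
  \<open>V\<^sup>j\<close>, so by Schur's lemma they are orthogonal and of equal norm.  The glued vector is therefore a
  Schmidt decomposition with \<open>2j + 1\<close> equal coefficients.
\<close>

section \<open>Tensor products of unitary representations\<close>

lemma spin_labels_Nil: "spin_labels [] = {[]}"
  by (auto simp: spin_labels_def)

lemma spin_labels_Cons:
  "spin_labels (n # ns) = (\<lambda>(a, as). a # as) ` ({..n} \<times> spin_labels ns)"
  by (auto simp: spin_labels_def list_all2_Cons2)

lemma finite_spin_labels: "finite (spin_labels ns)"
  by (induction ns) (simp_all add: spin_labels_Nil spin_labels_Cons)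

lemma length_spin_labels: "as \<in> spin_labels ns \<Longrightarrow> length as = length ns"
  by (auto simp: spin_labels_def dest: list_all2_lengthD)

lemma snoc_in_spin_labels:
  "as @ [c] \<in> spin_labels (ns @ [n]) \<longleftrightarrow> as \<in> spin_labels ns \<and> c \<le> n"
proof -
  have "list_all2 (\<le>) (as @ [c]) (ns @ [n]) \<longleftrightarrow> list_all2 (\<le>) (rev (as @ [c])) (rev (ns @ [n]))"
    by (rule list_all2_rev [symmetric])
  then show ?thesis
    by (auto simp: spin_labels_def)
qed

lemma sum_spin_labels_Cons:
  "(\<Sum>as\<in>spin_labels (n # ns). f as) = (\<Sum>a\<le>n. \<Sum>as\<in>spin_labels ns. f (a # as))"
proof -
  have "inj_on (\<lambda>(a, as). a # as) ({..n} \<times> spin_labels ns)"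
    by (auto simp: inj_on_def)
  then show ?thesis
    by (simp add: spin_labels_Cons sum.reindex sum.cartesian_product case_prod_unfold)
qed

lemma sum_spin_labels_snoc:
  "(\<Sum>as\<in>spin_labels (ns @ [n]). f as) = (\<Sum>as\<in>spin_labels ns. \<Sum>c\<le>n. f (as @ [c]))"
  by (induction ns arbitrary: f) (simp_all add: spin_labels_Nil sum_spin_labels_Cons)

text \<open>The matrix kernel of \<open>diagonal_action\<close>, named so that factors can be peeled
  from the front for inductions and from the back to isolate the common edge.\<close>

definition tensor_rep :: "nat list \<Rightarrow> complex^2^2 \<Rightarrow> nat list \<Rightarrow> nat list \<Rightarrow> complex" where
  "tensor_rep ns g as bs = (\<Prod>i<length ns. spin_rep (ns ! i) g (as ! i) (bs ! i))"

lemma tensor_rep_Cons: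
  "tensor_rep (n # ns) g (a # as) (b # bs) = spin_rep n g a b * tensor_rep ns g as bs"
  unfolding tensor_rep_def length_Cons prod.lessThan_Suc_shift by simp

lemma tensor_rep_snoc:
  assumes "as \<in> spin_labels ns" "bs \<in> spin_labels ns"
  shows "tensor_rep (ns @ [n]) g (as @ [a]) (bs @ [b]) = tensor_rep ns g as bs * spin_rep n g a b"
proof -
  note [simp] = length_spin_labels [OF assms(1)] length_spin_labels [OF assms(2)]
  have "(\<Prod>i<length ns. spin_rep ((ns @ [n]) ! i) g ((as @ [a]) ! i) ((bs @ [b]) ! i))
      = (\<Prod>i<length ns. spin_rep (ns ! i) g (as ! i) (bs ! i))"
    by (rule prod.cong) (auto simp: nth_append)
  then show ?thesis
    by (simp add: tensor_rep_def nth_append)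
qed

text \<open>The sum over label lists factorises into one sum per spin, and
  \<open>spin_rep_unitary\<close> evaluates each factor to a Kronecker delta.\<close>

lemma tensor_rep_unitary:
  assumes "g \<in> SU2"
  shows "as \<in> spin_labels ns \<Longrightarrow> bs \<in> spin_labels ns \<Longrightarrow>
    (\<Sum>cs\<in>spin_labels ns. cnj (tensor_rep ns g cs as) * tensor_rep ns g cs bs)
      = (if as = bs then 1 else 0)"
proof (induction ns arbitrary: as bs)
  case Nil
  then show ?case by (simp add: spin_labels_Nil tensor_rep_def)
next
  case (Cons n ns)
  then obtain a as' b bs' where ab: "as = a # as'" "bs = b # bs'" "a \<le> n" "b \<le> n"
    "as' \<in> spin_labels ns" "bs' \<in> spin_labels ns"
    by (auto simp: spin_labels_Cons)
  have "(\<Sum>cs\<in>spin_labels (n # ns). cnj (tensor_rep (n # ns) g cs as) * tensor_rep (n # ns) g cs bs)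
      = (\<Sum>c\<le>n. cnj (spin_rep n g c a) * spin_rep n g c b) *
        (\<Sum>cs\<in>spin_labels ns. cnj (tensor_rep ns g cs as') * tensor_rep ns g cs bs')"
    by (simp add: sum_spin_labels_Cons ab tensor_rep_Cons sum_product mult_ac)
  also have "\<dots> = (if as = bs then 1 else 0)"
    using ab Cons.IH [OF ab(5,6)] spin_rep_unitary [OF assms ab(3,4)] by simp
  finally show ?case .
qed

section \<open>Inner products in a finite orthonormal basis\<close>

definition inner_on :: "'a set \<Rightarrow> ('a \<Rightarrow> complex) \<Rightarrow> ('a \<Rightarrow> complex) \<Rightarrow> complex" where
  "inner_on X u v = (\<Sum>x\<in>X. cnj (u x) * v x)"

lemma inner_on_sum_right: "inner_on X u (\<lambda>x. \<Sum>i\<in>I. c i * v i x) = (\<Sum>i\<in>I. c i * inner_on X u (v i))"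
  unfolding inner_on_def sum_distrib_left by (subst sum.swap) (simp add: mult_ac)

lemma inner_on_cnj: "cnj (inner_on X u v) = inner_on X v u"
  by (simp add: inner_on_def mult.commute)

lemma inner_on_sum_left: "inner_on X (\<lambda>x. \<Sum>i\<in>I. c i * v i x) u = (\<Sum>i\<in>I. cnj (c i) * inner_on X (v i) u)"
  using arg_cong [OF inner_on_sum_right [where X = X and u = u and c = c and v = v and I = I], of cnj] by (simp add: inner_on_cnj)

lemma inner_on_self: "inner_on X u u = of_real (\<Sum>x\<in>X. (cmod (u x))\<^sup>2)"
  by (simp add: inner_on_def complex_norm_square mult.commute del: of_real_power)

text \<open>A matrix with orthonormal columns preserves inner products. This later removes the
  action of a group element on the boundary spins from the Gram matrix.\<close>

lemma inner_on_isometry: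
  assumes "finite X"
    and "\<And>y z. y \<in> X \<Longrightarrow> z \<in> X \<Longrightarrow> inner_on X (\<lambda>x. M x y) (\<lambda>x. M x z) = (if y = z then 1 else 0)"
  shows "inner_on X (\<lambda>x. \<Sum>y\<in>X. M x y * f y) (\<lambda>x. \<Sum>y\<in>X. M x y * h y) = inner_on X f h"
proof -
  have "inner_on X (\<lambda>x. \<Sum>y\<in>X. f y * M x y) (\<lambda>x. \<Sum>y\<in>X. h y * M x y)
      = (\<Sum>y\<in>X. cnj (f y) * (\<Sum>z\<in>X. h z * (if y = z then 1 else 0)))"
    using assms(2) by (simp add: inner_on_sum_left inner_on_sum_right cong: sum.cong)
  also have "\<dots> = inner_on X f h"
    using assms(1) by (simp add: inner_on_def if_distrib cong: if_cong)
  finally show ?thesis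
    by (simp add: mult.commute)
qed

section \<open>Schur's lemma for the Gram matrix of an intertwiner\<close>

lemma torus_in_SU2:
  "(vector [vector [exp (- \<i> * of_real t / 2), 0], vector [0, exp (\<i> * of_real t / 2)]] :: complex^2^2) \<in> SU2"
proof -
  have "exp (\<i> * of_real t / 2) * exp (- (\<i> * complex_of_real t / 2)) = 1"
    by (simp flip: exp_add)
  then show ?thesis
    by (simp add: SU2_def adjoint2_def matrix_matrix_mult_def sum_2 vec_eq_iff forall_2 mat_def
        det_2 exp_cnj mult.commute)
qed

text \<open>The 3-4-5 triangle supplies a rotation with rational entries, all nonzero, so that
  membership is plain arithmetic.\<close>

lemma rotation_in_SU2: "(vector [vector [3/5, 4/5], vector [-4/5, 3/5]] :: complex^2^2) \<in> SU2"
  by (simp add: SU2_def adjoint2_def matrix_matrix_mult_def sum_2 vec_eq_iff forall_2 mat_def det_2)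

text \<open>The binomial theorem for a power of \<open>s + t x\<close>, by Pascal's rule.\<close>

lemma coeff_linear_power:
  assumes "k \<le> m"
  shows "coeff ([:s, t:] ^ m) k = of_nat (m choose k) * t ^ k * (s :: complex) ^ (m - k)"
  using assms
proof (induction m arbitrary: k)
  case (Suc m)
  show ?case
  proof (cases k)
    case 0
    then show ?thesis using Suc.IH [of 0] by (simp add: mult_pCons_left)
  next
    case (Suc l)
    show ?thesis
    \<comment> \<open>For the top coefficient only the shifted summand survives, as \<open>k\<close>
      exceeds the degree of the \<open>m\<close>-th power.\<close>
    proof (cases "k = Suc m")
      case True
      have "coeff ([:s, t:] ^ m) k = 0"
        using True degree_linear_power_le [of s t m] by (intro coeff_eq_0) simp
      then show ?thesis using True Suc.IH [of m] by (simp add: mult_pCons_left)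
    next
      case False
      then have "m - l = Suc (m - k)" "l \<le> m" "k \<le> m" using Suc Suc.prems by auto
      then show ?thesis using Suc Suc.IH [of k] Suc.IH [of l]
        by (simp add: mult_pCons_left algebra_simps)
    qed
  qed
qed simp

text \<open>Column 0 is the image of the lowest weight vector, proportional to
  \<open>(4/5 x + 3/5 y)^n\<close>, whose coefficients are all positive.\<close>

lemma spin_rep_rotation_nonzero:
  assumes "a \<le> n"
  shows "spin_rep n (vector [vector [3/5, 4/5], vector [-4/5, 3/5]]) a 0 \<noteq> 0"
  using assms by (simp add: spin_rep_def coeff_linear_power)

text \<open>
  The diagonal torus forces \<open>G\<close> to be diagonal; a single rotation whose column 0 in \<open>V\<^sup>j\<close> has no zero
  entry then identifies all its diagonal entries.
\<close>

lemma Schur_spin_rep: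
  assumes comm: "\<And>g a b. g \<in> SU2 \<Longrightarrow> a \<le> n \<Longrightarrow> b \<le> n \<Longrightarrow>
      (\<Sum>c\<le>n. G a c * spin_rep n g c b) = (\<Sum>c\<le>n. spin_rep n g a c * G c b)"
    and ab: "a \<le> n" "b \<le> n"
  shows "G a b = (if a = b then G 0 0 else 0)"
proof -
  have off: "G a b = 0" if ab: "a \<le> n" "b \<le> n" "a \<noteq> b" for a b
  proof -
    \<comment> \<open>With this angle the torus phases of the weights \<open>a\<close> and
      \<open>b\<close> differ by the factor \<open>exp (- i pi) = -1\<close>, so commutation gives
      \<open>G a b = - G a b\<close>.\<close>
    define t where "t = pi / (real a - real b)"
    define e where "e c = exp (- \<i> * of_real t * of_real (real c - spin n))" for c
    define g :: "complex^2^2" where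
      "g = vector [vector [exp (- \<i> * of_real t / 2), 0], vector [0, exp (\<i> * of_real t / 2)]]"
    note torus = spin_rep_torus [of _ n _ t, folded e_def g_def]
    have "(\<Sum>c\<le>n. G a c * spin_rep n g c b) = (\<Sum>c\<le>n. if c = b then G a b * e b else 0)"
      using ab by (intro sum.cong) (auto simp: torus)
    then have l: "(\<Sum>c\<le>n. G a c * spin_rep n g c b) = G a b * e b"
      using ab by simp
    have "(\<Sum>c\<le>n. spin_rep n g a c * G c b) = (\<Sum>c\<le>n. if c = a then e a * G a b else 0)"
      using ab by (intro sum.cong) (auto simp: torus)
    then have r: "(\<Sum>c\<le>n. spin_rep n g a c * G c b) = e a * G a b"
      using ab by simp
    have "G a b * e b = e a * G a b"
      using comm [OF torus_in_SU2 [of t, folded g_def] ab(1,2)] unfolding l r .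
    moreover have "e a = - e b"
    proof -
      have "- \<i> * of_real t * of_real (real a - spin n)
          = - \<i> * of_real t * of_real (real b - spin n) + - (\<i> * of_real (t * (real a - real b)))"
        by (simp add: algebra_simps)
      also have "t * (real a - real b) = pi"
        using ab by (simp add: t_def)
      finally show ?thesis
        by (simp only: e_def exp_add) (simp add: exp_minus)
    qed
    moreover have "e b \<noteq> 0"
      by (simp add: e_def)
    ultimately show ?thesis by auto
  qed
  have diag: "G a a = G 0 0" if "a \<le> n" for a
  proof -
    let ?r = "spin_rep n (vector [vector [3/5, 4/5], vector [-4/5, 3/5]])"
    have "(\<Sum>c\<le>n. G a c * ?r c 0) = (\<Sum>c\<le>n. if c = a then G a a * ?r a 0 else 0)"
      using that by (intro sum.cong) (auto simp: off)
    moreover have "(\<Sum>c\<le>n. ?r a c * G c 0) = (\<Sum>c\<le>n. if c = 0 then ?r a 0 * G 0 0 else 0)"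
      by (intro sum.cong) (auto simp: off)
    ultimately have "G a a * ?r a 0 = ?r a 0 * G 0 0"
      using comm [OF rotation_in_SU2 that, of 0] that by simp
    then show ?thesis
      using spin_rep_rotation_nonzero [OF that] by simp
  qed
  show ?thesis
    using off [OF ab] diag [OF ab(1)] by auto
qed

section \<open>Invariance and the Gram matrix of the contractions\<close>

text \<open>Invariance read off at a fixed last label: the contractions are reproduced when
  \<open>g\<close> mixes them through \<open>spin_rep n g\<close> and at the same time acts on the
  boundary spins.\<close>

lemma intertwiner_contract_last:
  assumes I: "I \<in> intertwiners (ns @ [n])" and "g \<in> SU2" "as \<in> spin_labels ns" "a \<le> n"
  shows "contract_last a I as
    = (\<Sum>bs\<in>spin_labels ns. tensor_rep ns g as bs * (\<Sum>c\<le>n. spin_rep n g a c * contract_last c I bs))"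
proof -
  have "I (as @ [a]) = diagonal_action (ns @ [n]) g I (as @ [a])"
    using assms by (auto simp: intertwiners_def)
  also have "\<dots> = (\<Sum>bs\<in>spin_labels (ns @ [n]). tensor_rep (ns @ [n]) g (as @ [a]) bs * I bs)"
    using assms by (simp add: diagonal_action_def snoc_in_spin_labels tensor_rep_def)
  also have "\<dots> = (\<Sum>bs\<in>spin_labels ns. tensor_rep ns g as bs * (\<Sum>c\<le>n. spin_rep n g a c * contract_last c I bs))"
    using assms by (simp add: sum_spin_labels_snoc tensor_rep_snoc sum_distrib_left contract_last_def mult.assoc)
  finally show ?thesis
    by (simp add: contract_last_def)
qed

text \<open>With \<open>D\<close> for the matrix of \<open>g\<close>, invariance and unitarity on
  the boundary give \<open>G = D G D*\<close>. Hence \<open>G\<close> commutes with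
  \<open>D\<close>, and Schur's lemma makes it scalar.\<close>

lemma intertwiner_gram:
  assumes I: "I \<in> intertwiners (ns @ [n])" and ab: "a \<le> n" "b \<le> n"
  shows "inner_on (spin_labels ns) (contract_last a I) (contract_last b I)
    = (if a = b then inner_on (spin_labels ns) (contract_last 0 I) (contract_last 0 I) else 0)"
proof -
  let ?X = "spin_labels ns" and ?u = "\<lambda>c. contract_last c I"
  \<comment> \<open>The swapped arguments make \<open>G\<close> transform with \<open>D\<close> on
    the left and its adjoint on the right; the other order would produce the conjugate
    representation.\<close>
  define G where "G a b = inner_on ?X (?u b) (?u a)" for a b
  have "G b a = (if b = a then G 0 0 else 0)"
  proof (rule Schur_spin_rep [OF _ ab(2,1)])
    fix g a b
    assume g: "g \<in> SU2" and ab: "a \<le> n" "b \<le> n"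
    let ?D = "spin_rep n g"
    let ?w = "\<lambda>a bs. \<Sum>c\<le>n. ?D a c * ?u c bs"
    have inv: "G a d = (\<Sum>c\<le>n. ?D a c * (\<Sum>e\<le>n. cnj (?D d e) * G c e))" if "d \<le> n" for d
    proof -
      have "G a d = inner_on ?X (\<lambda>x. \<Sum>y\<in>?X. tensor_rep ns g x y * ?w d y)
                                (\<lambda>x. \<Sum>y\<in>?X. tensor_rep ns g x y * ?w a y)"
        unfolding G_def inner_on_def
        by (rule sum.cong) (simp_all flip: intertwiner_contract_last [OF I g] add: ab that)
      also have "\<dots> = inner_on ?X (?w d) (?w a)"
        by (rule inner_on_isometry [OF finite_spin_labels])
          (simp add: inner_on_def tensor_rep_unitary [OF g])
      also have "\<dots> = (\<Sum>c\<le>n. ?D a c * (\<Sum>e\<le>n. cnj (?D d e) * G c e))"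
        unfolding inner_on_sum_right unfolding inner_on_sum_left G_def ..
      finally show ?thesis .
    qed
    \<comment> \<open>Multiplying \<open>G = D G D*\<close> by \<open>D\<close> on the right and
      cancelling \<open>D* D = 1\<close> yields \<open>G D = D G\<close>.\<close>
    have "(\<Sum>d\<le>n. G a d * ?D d b)
        = (\<Sum>d\<le>n. \<Sum>c\<le>n. \<Sum>e\<le>n. ?D a c * (G c e * (cnj (?D d e) * ?D d b)))"
      by (intro sum.cong refl) (simp add: inv sum_distrib_left sum_distrib_right mult_ac)
    also have "\<dots> = (\<Sum>c\<le>n. \<Sum>e\<le>n. \<Sum>d\<le>n. ?D a c * (G c e * (cnj (?D d e) * ?D d b)))"
      by (subst sum.swap, rule sum.cong [OF refl], rule sum.swap)
    also have "\<dots> = (\<Sum>c\<le>n. ?D a c * (\<Sum>e\<le>n. G c e * (if e = b then 1 else 0)))"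
      using ab by (simp add: spin_rep_unitary [OF g] flip: sum_distrib_left)
    also have "\<dots> = (\<Sum>c\<le>n. ?D a c * G c b)"
      using ab by (simp add: if_distrib cong: if_cong)
    finally show "(\<Sum>d\<le>n. G a d * ?D d b) = (\<Sum>c\<le>n. ?D a c * G c b)" .
  qed
  then show ?thesis
    by (auto simp: G_def)
qed

section \<open>Entropy of a diagonalised density matrix\<close>

definition orthonormal_on :: "'a set \<Rightarrow> 'k set \<Rightarrow> ('k \<Rightarrow> 'a \<Rightarrow> complex) \<Rightarrow> bool" where
  "orthonormal_on X K e \<longleftrightarrow> (\<forall>k\<in>K. \<forall>l\<in>K. inner_on X (e k) (e l) = (if k = l then 1 else 0))"

text \<open>
  \<open>defect K e x\<close> is the component of the basis vector \<open>x\<close> orthogonal to all \<open>e k\<close>.  The squared norms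
  of these components sum to \<open>card X - card K\<close>, which gives the dimension bound, the completeness
  relation and the extension step without a Gram-Schmidt procedure.
\<close>

definition defect :: "'k set \<Rightarrow> ('k \<Rightarrow> 'a \<Rightarrow> complex) \<Rightarrow> 'a \<Rightarrow> 'a \<Rightarrow> complex" where
  "defect K e x y = (if x = y then 1 else 0) - (\<Sum>k\<in>K. cnj (e k x) * e k y)"

lemma defect_orthogonal:
  assumes "finite X" "finite K" "orthonormal_on X K e" "x \<in> X" "k \<in> K"
  shows "inner_on X (e k) (defect K e x) = 0"
proof -
  have "inner_on X (e k) (defect K e x)
      = inner_on X (e k) (\<lambda>y. if x = y then 1 else 0) - inner_on X (e k) (\<lambda>y. \<Sum>l\<in>K. cnj (e l x) * e l y)"
    by (simp add: inner_on_def defect_def right_diff_distrib sum_subtractf)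
  also have "inner_on X (e k) (\<lambda>y. if x = y then 1 else 0) = cnj (e k x)"
    using assms by (simp add: inner_on_def if_distrib cong: if_cong)
  also have "inner_on X (e k) (\<lambda>y. \<Sum>l\<in>K. cnj (e l x) * e l y) = (\<Sum>l\<in>K. if k = l then cnj (e l x) else 0)"
    unfolding inner_on_sum_right using assms by (intro sum.cong) (auto simp: orthonormal_on_def)
  finally show ?thesis
    using assms by simp
qed

text \<open>The defects are the columns of the orthogonal projection onto the complement of the
  span. Being idempotent and Hermitian, it has its diagonal entries as squared column norms, so the
  sum is its trace.\<close>

lemma defect_norm:
  assumes "finite X" "finite K" "orthonormal_on X K e"
  shows "(\<Sum>x\<in>X. inner_on X (defect K e x) (defect K e x)) = of_nat (card X) - of_nat (card K)"
proof -
  have "inner_on X (defect K e x) (defect K e x) = defect K e x x" if "x \<in> X" for x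
  proof -
    have "inner_on X (defect K e x) (defect K e x)
      = inner_on X (defect K e x) (\<lambda>y. if x = y then 1 else 0)
        - inner_on X (defect K e x) (\<lambda>y. \<Sum>k\<in>K. cnj (e k x) * e k y)"
      by (simp add: inner_on_def defect_def right_diff_distrib sum_subtractf)
    also have "inner_on X (defect K e x) (\<lambda>y. \<Sum>k\<in>K. cnj (e k x) * e k y)
        = (\<Sum>k\<in>K. cnj (e k x) * cnj (inner_on X (e k) (defect K e x)))"
      by (simp add: inner_on_sum_right inner_on_cnj)
    also have "\<dots> = 0"
      using defect_orthogonal [OF assms that] by simp
    also have "inner_on X (defect K e x) (\<lambda>y. if x = y then 1 else 0) = cnj (defect K e x x)"
      using assms that by (simp add: inner_on_def if_distrib cong: if_cong)
    also have "cnj (defect K e x x) = defect K e x x"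
      by (simp add: defect_def mult.commute)
    finally show ?thesis by simp
  qed
  then have "(\<Sum>x\<in>X. inner_on X (defect K e x) (defect K e x))
      = (\<Sum>x\<in>X. 1 - (\<Sum>k\<in>K. cnj (e k x) * e k x))"
    by (simp add: defect_def)
  also have "\<dots> = of_nat (card X) - (\<Sum>k\<in>K. inner_on X (e k) (e k))"
    unfolding inner_on_def sum_subtractf by (subst (2) sum.swap) simp
  also have "(\<Sum>k\<in>K. inner_on X (e k) (e k)) = of_nat (card K)"
    using assms by (simp add: orthonormal_on_def)
  finally show ?thesis .
qed

lemma orthonormal_on_card_le:
  assumes "finite X" "finite K" "orthonormal_on X K e"
  shows "card K \<le> card X"
proof -
  have "0 \<le> (\<Sum>x\<in>X. \<Sum>y\<in>X. (cmod (defect K e x y))\<^sup>2)"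
    by (simp add: sum_nonneg)
  also have "complex_of_real \<dots> = of_real (real (card X) - real (card K))"
    using defect_norm [OF assms] by (simp add: inner_on_self)
  then have "(\<Sum>x\<in>X. \<Sum>y\<in>X. (cmod (defect K e x y))\<^sup>2) = real (card X) - real (card K)"
    unfolding of_real_eq_iff .
  finally show ?thesis by simp
qed

text \<open>When the cardinalities agree, the squared norms of the defects sum to zero, so every
  defect vanishes; entrywise this is the completeness relation.\<close>

lemma orthonormal_on_complete:
  assumes X: "finite X" "finite K" "orthonormal_on X K e" and "card K = card X"
    and xy: "x \<in> X" "y \<in> X"
  shows "(\<Sum>k\<in>K. e k x * cnj (e k y)) = (if x = y then 1 else 0)"
proof -
  have "complex_of_real (\<Sum>x\<in>X. \<Sum>y\<in>X. (cmod (defect K e x y))\<^sup>2) = of_real 0"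
    using defect_norm [OF X] assms(4) by (simp add: inner_on_self)
  then have "(\<Sum>x\<in>X. \<Sum>y\<in>X. (cmod (defect K e x y))\<^sup>2) = 0"
    unfolding of_real_eq_iff .
  then have "defect K e y x = 0"
    using X xy by (simp add: sum_nonneg_eq_0_iff sum_nonneg)
  then show ?thesis
    by (auto simp: defect_def mult.commute split: if_splits)
qed

text \<open>The defects cannot all vanish, since their squared norms have a positive sum. A nonzero
  one, normalised, is the new vector.\<close>

lemma orthonormal_on_extend_one:
  assumes X: "finite X" "finite K" "orthonormal_on X K e" and "card K < card X" and "l \<notin> K"
  shows "\<exists>w. orthonormal_on X (insert l K) (e(l := w))"
proof -
  have "\<exists>x\<in>X. inner_on X (defect K e x) (defect K e x) \<noteq> 0"
  proof (rule ccontr)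
    assume "\<not> ?thesis"
    then have "(\<Sum>x\<in>X. inner_on X (defect K e x) (defect K e x)) = 0"
      by simp
    then show False
      using defect_norm [OF X] assms(4) by simp
  qed
  then obtain x where x: "x \<in> X" "inner_on X (defect K e x) (defect K e x) \<noteq> 0" by blast
  define r where "r = (\<Sum>y\<in>X. (cmod (defect K e x y))\<^sup>2)"
  have r: "inner_on X (defect K e x) (defect K e x) = of_real r"
    by (simp add: inner_on_self r_def)
  have "r \<noteq> 0"
    using x(2) unfolding r by simp
  then have "r > 0"
    by (simp add: r_def sum_nonneg less_le)
  define w where "w y = defect K e x y / of_real (sqrt r)" for y
  have "inner_on X w w = inner_on X (defect K e x) (defect K e x) / of_real (sqrt r * sqrt r)"
    by (simp add: inner_on_def w_def sum_divide_distrib del: real_sqrt_mult_self)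
  then have ww: "inner_on X w w = 1"
    using \<open>r > 0\<close> by (simp add: r)
  have ew: "inner_on X (e k) w = 0" if "k \<in> K" for k
  proof -
    have "inner_on X (e k) w = inner_on X (e k) (defect K e x) / of_real (sqrt r)"
      by (simp add: inner_on_def w_def sum_divide_distrib)
    then show ?thesis
      using defect_orthogonal [OF X x(1) that] by simp
  qed
  have we: "inner_on X w (e k) = 0" if "k \<in> K" for k
    using ew [OF that] inner_on_cnj [of X "e k" w] by simp
  have "orthonormal_on X (insert l K) (e(l := w))"
    using X(3) ww ew we \<open>l \<notin> K\<close> by (auto simp: orthonormal_on_def)
  then show ?thesis by blast
qed

text \<open>The family is indexed by a subset of \<open>X\<close> so that its completion is indexed
  by \<open>X\<close> itself, the shape that \<open>unitary_on\<close> demands.\<close>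

lemma orthonormal_on_extend:
  assumes "finite X" "K \<subseteq> X" "orthonormal_on X K e"
  shows "\<exists>e'. orthonormal_on X X e' \<and> (\<forall>k\<in>K. e' k = e k)"
  using assms
proof (induction "card (X - K)" arbitrary: K e)
  case 0
  then have "K = X" by auto
  then show ?case using 0 by blast
next
  case (Suc m)
  then obtain l where l: "l \<in> X" "l \<notin> K"
    by (metis DiffE card.empty ex_in_conv nat.distinct(1))
  have "finite K"
    using Suc.prems finite_subset by blast
  moreover have "card K < card X"
    using Suc.prems l by (intro psubset_card_mono) auto
  ultimately obtain w where w: "orthonormal_on X (insert l K) (e(l := w))"
    using orthonormal_on_extend_one Suc.prems l by metis
  have "X - insert l K = (X - K) - {l}" by auto
  then have "m = card (X - insert l K)"
    using Suc.hyps(2) l Suc.prems by simp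
  then obtain e' where "orthonormal_on X X e'" "\<forall>k\<in>insert l K. e' k = (e(l := w)) k"
    using Suc.hyps(1) w Suc.prems l by (metis insert_subset)
  then show ?case
    using l by (intro exI [of _ e']) auto
qed

lemma unitary_on_orthonormal:
  assumes "finite X" "orthonormal_on X X e"
  shows "unitary_on X (\<lambda>x k. e k x)"
  using assms orthonormal_on_complete [OF assms(1,1,2)]
  by (auto simp: unitary_on_def orthonormal_on_def inner_on_def)

section \<open>Entropy from an eigenbasis\<close>

lemma von_neumann_entropy_diag_conj:
  assumes X: "finite X" and U: "unitary_on X U"
    and A: "\<And>x y. x \<in> X \<Longrightarrow> y \<in> X \<Longrightarrow> A x y = diag_conj X U d x y"
  shows "von_neumann_entropy X A = - (\<Sum>k\<in>X. d k * ln (d k))"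
proof -
  have U1: "(\<Sum>x\<in>X. cnj (U x k) * U x l) = (if k = l then 1 else 0)" if "k \<in> X" "l \<in> X" for k l
    using U that by (simp add: unitary_on_def)
  have S: "spectral_fun X ln A = diag_conj X U (ln \<circ> d)"
    by (rule spectral_fun_eq [OF X U A])
  have "(\<Sum>x\<in>X. \<Sum>y\<in>X. A x y * spectral_fun X ln A y x)
      = (\<Sum>x\<in>X. \<Sum>y\<in>X. \<Sum>k\<in>X. \<Sum>l\<in>X. of_real (d k) * of_real (ln (d l))
          * ((cnj (U x l) * U x k) * (cnj (U y k) * U y l)))"
  proof (intro sum.cong refl)
    fix x y
    assume xy: "x \<in> X" "y \<in> X"
    then have "A x y * spectral_fun X ln A y x
        = (\<Sum>k\<in>X. U x k * of_real (d k) * cnj (U y k)) * (\<Sum>l\<in>X. U y l * of_real (ln (d l)) * cnj (U x l))"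
      by (simp add: S A diag_conj_def)
    also have "\<dots> = (\<Sum>k\<in>X. \<Sum>l\<in>X. of_real (d k) * of_real (ln (d l))
          * ((cnj (U x l) * U x k) * (cnj (U y k) * U y l)))"
      unfolding sum_product by (intro sum.cong refl) (simp only: mult_ac)
    finally show "A x y * spectral_fun X ln A y x
        = (\<Sum>k\<in>X. \<Sum>l\<in>X. of_real (d k) * of_real (ln (d l))
          * ((cnj (U x l) * U x k) * (cnj (U y k) * U y l)))" .
  qed
  \<comment> \<open>The exchanges move the eigenvalue indices \<open>k\<close> and \<open>l\<close>
    outside, where the sums over \<open>x\<close> and \<open>y\<close> separate into two
    orthogonality relations.\<close>
  also have "\<dots> = (\<Sum>x\<in>X. \<Sum>k\<in>X. \<Sum>y\<in>X. \<Sum>l\<in>X. of_real (d k) * of_real (ln (d l))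
          * ((cnj (U x l) * U x k) * (cnj (U y k) * U y l)))"
    by (rule sum.cong [OF refl], rule sum.swap)
  also have "\<dots> = (\<Sum>k\<in>X. \<Sum>x\<in>X. \<Sum>l\<in>X. \<Sum>y\<in>X. of_real (d k) * of_real (ln (d l))
          * ((cnj (U x l) * U x k) * (cnj (U y k) * U y l)))"
    by (subst sum.swap, rule sum.cong [OF refl], rule sum.cong [OF refl], rule sum.swap)
  also have "\<dots> = (\<Sum>k\<in>X. \<Sum>l\<in>X. \<Sum>x\<in>X. \<Sum>y\<in>X. of_real (d k) * of_real (ln (d l))
          * ((cnj (U x l) * U x k) * (cnj (U y k) * U y l)))"
    by (rule sum.cong [OF refl], rule sum.swap)
  also have "\<dots> = (\<Sum>k\<in>X. \<Sum>l\<in>X. of_real (d k) * of_real (ln (d l))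
          * ((\<Sum>x\<in>X. cnj (U x l) * U x k) * (\<Sum>y\<in>X. cnj (U y k) * U y l)))"
    by (simp add: sum_product flip: sum_distrib_left)
  also have "\<dots> = (\<Sum>k\<in>X. \<Sum>l\<in>X. if k = l then of_real (d k * ln (d k)) else 0)"
    by (intro sum.cong refl) (simp add: U1)
  also have "\<dots> = of_real (\<Sum>k\<in>X. d k * ln (d k))"
    using X by simp
  finally show ?thesis
    by (simp add: von_neumann_entropy_def)
qed

text \<open>Such a matrix is a projection of rank \<open>n + 1\<close> divided by its rank: its
  nonzero eigenvalues are \<open>n + 1\<close> copies of \<open>1 / (n + 1)\<close>.\<close>

lemma von_neumann_entropy_flat:
  assumes X: "finite X" and e: "orthonormal_on X {..n} e"
    and A: "\<And>x y. x \<in> X \<Longrightarrow> y \<in> X \<Longrightarrow> A x y = (\<Sum>c\<le>n. e c x * cnj (e c y)) / of_nat (Suc n)"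
  shows "von_neumann_entropy X A = ln (real (Suc n))"
proof -
  have "card {..n} \<le> card X"
    using orthonormal_on_card_le [OF X _ e] by simp
  \<comment> \<open>Eigenvectors in \<open>diag_conj\<close> are indexed by \<open>X\<close>, so the
    labels \<open>0..n\<close> are embedded into \<open>X\<close>; there is room because an
    orthonormal family has at most \<open>card X\<close> members.\<close>
  then obtain p where p: "p ` {..n} \<subseteq> X" "inj_on p {..n}"
    using card_le_inj [OF _ X] by blast
  define K where "K = p ` {..n}"
  define q where "q = the_inv_into {..n} p"
  have q: "q (p c) = c" if "c \<le> n" for c
    using the_inv_into_f_f [OF p(2)] that by (simp add: q_def)
  have KX: "K \<subseteq> X"
    using p by (simp add: K_def)
  have "orthonormal_on X K (\<lambda>k. e (q k))"
    using e by (auto simp: orthonormal_on_def K_def q inj_on_eq_iff [OF p(2)])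
  from orthonormal_on_extend [OF X KX this] obtain e' where e': "orthonormal_on X X e'" "\<And>k. k \<in> K \<Longrightarrow> e' k = e (q k)"
    by auto
  \<comment> \<open>The eigenvectors added by the completion get eigenvalue 0 and drop out of the
    entropy.\<close>
  define d where "d k = (if k \<in> K then 1 / real (Suc n) else 0)" for k
  have cut: "(\<Sum>k\<in>X. if k \<in> K then f k else 0) = (\<Sum>c\<le>n. f (p c))" for f :: "'a \<Rightarrow> 'b::comm_monoid_add"
  proof -
    have "(\<Sum>k\<in>X. if k \<in> K then f k else 0) = sum f (X \<inter> K)"
      using X by (simp add: sum.If_cases)
    also have "X \<inter> K = K" using p by (auto simp: K_def)
    finally show ?thesis
      using p by (simp add: K_def sum.reindex)
  qed
  have "A x y = diag_conj X (\<lambda>x k. e' k x) d x y" if "x \<in> X" "y \<in> X" for x y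
  proof -
    have "diag_conj X (\<lambda>x k. e' k x) d x y
        = (\<Sum>k\<in>X. if k \<in> K then e (q k) x * cnj (e (q k) y) / of_nat (Suc n) else 0)"
      unfolding diag_conj_def using that by (auto simp: d_def e' intro!: sum.cong)
    also have "\<dots> = (\<Sum>c\<le>n. e c x * cnj (e c y) / of_nat (Suc n))"
      unfolding cut by (simp add: q)
    finally show ?thesis
      using A [OF that] by (simp add: sum_divide_distrib)
  qed
  then have "von_neumann_entropy X A = - (\<Sum>k\<in>X. d k * ln (d k))"
    by (rule von_neumann_entropy_diag_conj [OF X unitary_on_orthonormal [OF X e'(1)]])
  also have "(\<Sum>k\<in>X. d k * ln (d k)) = (\<Sum>k\<in>X. if k \<in> K then 1 / real (Suc n) * ln (1 / real (Suc n)) else 0)"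
    by (intro sum.cong) (auto simp: d_def)
  also have "\<dots> = - ln (real (Suc n))"
    unfolding cut by (simp add: ln_div del: of_nat_Suc)
  finally show ?thesis by simp
qed

section \<open>Entanglement of the glued state\<close>

text \<open>Splitting off the last label writes the squared norm as a sum over the contractions.
  This ties their common squared norm \<alpha> to the normalisation of the intertwiner.\<close>

lemma ket_norm_snoc_square:
  assumes "\<And>c. c \<le> n \<Longrightarrow> inner_on (spin_labels ns) (contract_last c I) (contract_last c I) = of_real \<alpha>"
  shows "(ket_norm (spin_labels (ns @ [n])) I)\<^sup>2 = real (Suc n) * \<alpha>"
proof -
  have "complex_of_real ((ket_norm (spin_labels (ns @ [n])) I)\<^sup>2)
      = (\<Sum>c\<le>n. inner_on (spin_labels ns) (contract_last c I) (contract_last c I))"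
    unfolding ket_norm_def sum_spin_labels_snoc
    by (subst sum.swap) (simp add: inner_on_self contract_last_def sum_nonneg)
  also have "\<dots> = of_real (real (Suc n) * \<alpha>)"
    using assms by simp
  finally show ?thesis
    unfolding of_real_eq_iff .
qed

lemma ket_norm_tensor: "ket_norm (X \<times> Y) (tensor u v) = ket_norm X u * ket_norm Y v"
  by (simp add: ket_norm_def tensor_def sum.cartesian_product' norm_mult power_mult_distrib
      sum_product real_sqrt_mult flip: real_sqrt_mult)

text \<open>Tracing out \<open>Y\<close> kills the cross terms, because the contractions on that
  side are orthogonal and the reversal of labels in the singlet is injective.\<close>

lemma reduced_density_glue:
  assumes "\<And>a b. a \<le> n \<Longrightarrow> b \<le> n \<Longrightarrow>
      inner_on Y (contract_last a v) (contract_last b v) = (if a = b then of_real \<beta> else 0)"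
  shows "reduced_density Y (glue n (tensor u v)) x x'
    = of_real (\<beta> / real (Suc n)) * (\<Sum>c\<le>n. contract_last c u x * cnj (contract_last c u x'))"
proof -
  define k where "k = complex_of_real (1 / sqrt (2 * spin n + 1))"
  have kk: "k * cnj k = of_real (1 / real (Suc n))"
    unfolding k_def by (simp add: spin_def flip: of_real_mult)
  let ?s = "\<lambda>c. (-1) ^ (n - c) :: complex"
  let ?u = "\<lambda>c. contract_last c u" and ?v = "\<lambda>c. contract_last (n - c) v"
  have "glue n (tensor u v) (x, y) = (\<Sum>c\<le>n. (k * ?s c * ?u c x) * ?v c y)" for x y
    by (simp add: glue_def tensor_def contract_last_def k_def sum_distrib_left mult_ac)
  then have "reduced_density Y (glue n (tensor u v)) x x'
      = inner_on Y (\<lambda>y. \<Sum>c\<le>n. (k * ?s c * ?u c x') * ?v c y) (\<lambda>y. \<Sum>c\<le>n. (k * ?s c * ?u c x) * ?v c y)"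
    by (simp add: reduced_density_def inner_on_def mult.commute)
  also have "\<dots> = (\<Sum>c\<le>n. \<Sum>d\<le>n. if c = d then (k * cnj k) * of_real \<beta> * (?u c x * cnj (?u c x')) else 0)"
    unfolding inner_on_sum_left inner_on_sum_right sum_distrib_left
  proof (intro sum.cong refl)
    fix c d
    assume cd: "c \<in> {..n}" "d \<in> {..n}"
    \<comment> \<open>On the diagonal each singlet sign meets itself and disappears.\<close>
    have "?s c * ?s c = 1" by (simp flip: power_mult_distrib)
    then show "cnj (k * ?s c * ?u c x') * ((k * ?s d * ?u d x) * inner_on Y (?v c) (?v d))
        = (if c = d then (k * cnj k) * of_real \<beta> * (?u c x * cnj (?u c x')) else 0)"
      using cd assms [of "n - c" "n - d"] by (auto simp: algebra_simps)
  qed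
  finally show ?thesis
    by (simp add: kk sum_distrib_left)
qed

theorem corollaryI2:
  fixes js ks :: "nat list" and j :: nat
    and I_A I_B :: "nat list \<Rightarrow> complex"
  assumes "length js \<ge> 1" and "length ks \<ge> 1"
    and "I_A \<in> intertwiners (js @ [j])"
    and "I_B \<in> intertwiners (ks @ [j])"
    and "ket_norm (spin_labels (js @ [j]) \<times> spin_labels (ks @ [j])) (tensor I_A I_B) = 1"
  shows "boundary_entanglement js ks j (tensor I_A I_B) = ln (2 * spin j + 1)"
proof -
  let ?X = "spin_labels js" and ?Y = "spin_labels ks"
  let ?u = "\<lambda>c. contract_last c I_A"
  define \<alpha> where "\<alpha> = (\<Sum>x\<in>?X. (cmod (?u 0 x))\<^sup>2)"
  define \<beta> where "\<beta> = (\<Sum>y\<in>?Y. (cmod (contract_last 0 I_B y))\<^sup>2)"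
  note A = intertwiner_gram [OF assms(3), unfolded inner_on_self [of _ "?u 0"], folded \<alpha>_def]
  note B = intertwiner_gram [OF assms(4), unfolded inner_on_self [of _ "contract_last 0 I_B"], folded \<beta>_def]
  have "1 = (ket_norm (spin_labels (js @ [j])) I_A)\<^sup>2 * (ket_norm (spin_labels (ks @ [j])) I_B)\<^sup>2"
    using assms(5) by (simp add: ket_norm_tensor flip: power_mult_distrib)
  \<comment> \<open>Normalisation enters here: it excludes \<alpha> = 0 and \<beta> = 0, hence a
    vanishing glued vector.\<close>
  then have "1 = (real (Suc j) * \<alpha>) * (real (Suc j) * \<beta>)"
    using ket_norm_snoc_square [of j js I_A \<alpha>] ket_norm_snoc_square [of j ks I_B \<beta>] A B by simp
  then have "\<alpha> \<noteq> 0" "\<beta> \<noteq> 0"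
    by auto
  then have pos: "\<alpha> > 0" "\<beta> > 0"
    by (simp_all add: \<alpha>_def \<beta>_def sum_nonneg less_le)
  let ?\<phi> = "glue j (tensor I_A I_B)"
  define r where "r = ket_norm (?X \<times> ?Y) ?\<phi>"
  have rd: "reduced_density ?Y ?\<phi> x y
      = of_real (\<beta> / real (Suc j)) * (\<Sum>c\<le>j. ?u c x * cnj (?u c y))" for x y
    by (rule reduced_density_glue [OF B])
  \<comment> \<open>The squared norm of the glued vector is the trace of its unnormalised reduced
    density.\<close>
  have "complex_of_real (r\<^sup>2) = (\<Sum>x\<in>?X. reduced_density ?Y ?\<phi> x x)"
    by (simp add: r_def ket_norm_def sum_nonneg reduced_density_def sum.cartesian_product' complex_norm_square
        del: of_real_power)
  also have "\<dots> = of_real (\<beta> / real (Suc j)) * (\<Sum>c\<le>j. inner_on ?X (?u c) (?u c))"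
    unfolding rd inner_on_def sum_distrib_left by (subst sum.swap) (simp add: mult_ac)
  also have "\<dots> = of_real (\<alpha> * \<beta>)"
    using A by (simp add: divide_simps del: of_nat_Suc)
  finally have r: "r\<^sup>2 = \<alpha> * \<beta>"
    unfolding of_real_eq_iff .
  \<comment> \<open>These are the Schmidt vectors on the side of \<open>A\<close>.\<close>
  define e where "e c x = ?u c x / of_real (sqrt \<alpha>)" for c x
  have sq: "complex_of_real (sqrt \<alpha>) * of_real (sqrt \<alpha>) = of_real \<alpha>"
    using pos by (simp flip: of_real_mult)
  have "inner_on ?X (e a) (e b) = inner_on ?X (?u a) (?u b) / of_real \<alpha>" for a b
    by (simp add: inner_on_def e_def sum_divide_distrib sq)
  then have e: "orthonormal_on ?X {..j} e"
    using A pos by (simp add: orthonormal_on_def)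
  have "von_neumann_entropy ?X (reduced_density ?Y (\<lambda>x. ?\<phi> x / of_real r)) = ln (real (Suc j))"
  proof (rule von_neumann_entropy_flat [OF finite_spin_labels e])
    fix x y
    have "reduced_density ?Y (\<lambda>x. ?\<phi> x / of_real r) x y = reduced_density ?Y ?\<phi> x y / of_real (r\<^sup>2)"
      by (simp add: reduced_density_def sum_divide_distrib power2_eq_square)
    \<comment> \<open>Dividing by \<open>r^2\<close> cancels \<beta> and leaves \<alpha>, which the
      normalisation of \<open>e\<close> absorbs; the equal weights
      \<open>1 / (2 * spin j + 1)\<close> remain.\<close>
    also have "\<dots> = (\<Sum>c\<le>j. ?u c x * cnj (?u c y)) / of_real \<alpha> / of_nat (Suc j)"
      unfolding rd r using pos by (simp add: divide_simps del: of_nat_Suc)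
    also have "(\<Sum>c\<le>j. ?u c x * cnj (?u c y)) / of_real \<alpha> = (\<Sum>c\<le>j. e c x * cnj (e c y))"
      by (simp add: e_def sum_divide_distrib sq)
    finally show "reduced_density ?Y (\<lambda>x. ?\<phi> x / of_real r) x y
        = (\<Sum>c\<le>j. e c x * cnj (e c y)) / of_nat (Suc j)" .
  qed
  then show ?thesis
    by (simp add: boundary_entanglement_def entanglement_def r_def spin_def add.commute)
qed

end
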